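(* Let $G$ be a compact Hausdorff topological group, let $X$ be a $G$-space and let $\star\in X^G$. Then ${}_{\{\star\}}\mathrm{cat}_G(X)\le TC^G(X)$. In particular, $\mathrm{cat}_G(X)\le TC^G(X)$.
   Context: $X^G$ denotes the set of points of $X$ fixed by all of $G$. Let $A\subseteq X$ be a closed $G$-invariant subset. An open $G$-invariant subset $U\subseteq X$ is $G$-compressible into $A$ if the inclusion $U\hookrightarrow X$ is $G$-homotopic to a $G$-equivariant map $c\colon U\to X$ with $c(U)\subseteq A$. For $\star\in X^G$, ${}_{\{\star\}}\mathrm{cat}_G(X)$ is the least integer $m\ge1$ such that $X$ has an open cover by $m$ ($G$-invariant) sets that are $G$-compressible into $\{\star\}$. A $G$-invariant subset $U\subseteq X$ is $G$-categorical if the inclusion $U\hookrightarrow X$ is $G$-homotopic to a map with values in a single orbit; the Lusternik--Schnirelmann $G$-category $\mathrm{cat}_G(X)$ is the least integer $m\ge1$ such that $X$ has an open cover by $m$ $G$-categorical sets. All these invariants are $\infty$ if no such $m$ exists. $PX$ is the space of continuous paths $\gamma\colon[0,1]\to X$ with the compact-open topology, and $G$ acts on it by $(g\gamma)(t)=g(\gamma(t))$. Let $PX\times_{X/G}PX=\{(\gamma,\delta)\in PX\times PX \mid G\gamma(1)=G\delta(0)\}$, with $G\times G$ acting by $(g_1,g_2)(\gamma,\delta)=(g_1\gamma,g_2\delta)$; let $G\times G$ act on $X\times X$ by $(g_1,g_2)(x,y)=(g_1x,g_2y)$; and let $\pi^G(\gamma,\delta)=(\gamma(0),\delta(1))$.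 Invariant topological complexity $TC^G(X)$ is the least integer $m\ge1$ such that $X\times X$ can be covered by $m$ open $(G\times G)$-invariant sets $U_1,\dots,U_m$, each admitting a $(G\times G)$-equivariant continuous map $s_i\colon U_i\to PX\times_{X/G}PX$ with $\pi^G\circ s_i$ equal to the inclusion $U_i\hookrightarrow X\times X$ ($\infty$ if no such $m$ exists). *)

theory Defs
  imports
    "HOL-Analysis.Analysis"
    "HOL-Algebra.Group_Action"
    "HOL-Library.Extended_Nat"
begin

section \<open>Topological groups and their actions\<close>

locale topological_group = group G for G (structure) +
  fixes T
  assumes topspace_eq_carrier: "topspace T = carrier G"
    and continuous_mult: "continuous_map (prod_topology T T) T (\<lambda>(g, h). g \<otimes> h)"
    and continuous_inv: "continuous_map T T (\<lambda>g. inv g)"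

text \<open>
  No separation axiom is imposed on the space.  As usual for \<open>group_action\<close>, the maps
  \<open>\<phi> g\<close> are extensional on the space; this only fixes junk values.
\<close>

locale G_space = topological_group G T + group_action G "topspace X" \<phi>
  for G (structure) and T and X and \<phi> +
  assumes continuous_action: "continuous_map (prod_topology T X) X (\<lambda>(g, x). \<phi> g x)"

definition fixed_points ::
    "('g, 'm) monoid_scheme \<Rightarrow> ('g \<Rightarrow> 'a \<Rightarrow> 'a) \<Rightarrow> 'a topology \<Rightarrow> 'a set" where
  "fixed_points G \<phi> X = {x \<in> topspace X. \<forall>g\<in>carrier G. \<phi> g x = x}"

definition G_invariant ::
    "('g, 'm) monoid_scheme \<Rightarrow> ('g \<Rightarrow> 'a \<Rightarrow> 'a) \<Rightarrow> 'a set \<Rightarrow> bool" where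
  "G_invariant G \<phi> U \<longleftrightarrow> (\<forall>g\<in>carrier G. \<forall>x\<in>U. \<phi> g x \<in> U)"

definition G_equivariant ::
    "('g, 'm) monoid_scheme \<Rightarrow> ('g \<Rightarrow> 'a \<Rightarrow> 'a) \<Rightarrow> ('g \<Rightarrow> 'b \<Rightarrow> 'b) \<Rightarrow> 'a set \<Rightarrow> ('a \<Rightarrow> 'b) \<Rightarrow> bool" where
  "G_equivariant G \<phi> \<psi> U f \<longleftrightarrow> (\<forall>g\<in>carrier G. \<forall>x\<in>U. f (\<phi> g x) = \<psi> g (f x))"

text \<open>
  A \<open>G\<close>-homotopy is an equivariant map on \<open>[0,1] \<times> U\<close>, with \<open>G\<close> acting trivially
  on \<open>[0,1]\<close>, that is, a homotopy every stage of which is equivariant.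
\<close>

definition inclusion_G_homotopic ::
    "('g, 'm) monoid_scheme \<Rightarrow> 'a topology \<Rightarrow> ('g \<Rightarrow> 'a \<Rightarrow> 'a) \<Rightarrow> 'a set \<Rightarrow> ('a \<Rightarrow> 'a) \<Rightarrow> bool" where
  "inclusion_G_homotopic G X \<phi> U c \<longleftrightarrow>
     homotopic_with (G_equivariant G \<phi> \<phi> U) (subtopology X U) X id c"

definition product_action ::
    "('g \<Rightarrow> 'a \<Rightarrow> 'a) \<Rightarrow> ('h \<Rightarrow> 'b \<Rightarrow> 'b) \<Rightarrow> 'g \<times> 'h \<Rightarrow> 'a \<times> 'b \<Rightarrow> 'a \<times> 'b" where
  "product_action \<phi> \<psi> = (\<lambda>(g, h) (x, y). (\<phi> g x, \<psi> h y))"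

section \<open>Equivariant Lusternik--Schnirelmann invariants\<close>

text \<open>
  The least \<open>m \<ge> 1\<close> such that \<open>X\<close> has a cover by \<open>m\<close> open sets satisfying \<open>P\<close>; it is
  \<open>\<infinity>\<close> if there is none, because the infimum of the empty set of \<open>enat\<close> is \<open>\<infinity>\<close>.
\<close>

definition open_cover_number :: "'a topology \<Rightarrow> ('a set \<Rightarrow> bool) \<Rightarrow> enat" where
  "open_cover_number X P =
     Inf (enat ` {m. m \<ge> 1 \<and>
       (\<exists>U :: nat \<Rightarrow> 'a set. (\<forall>i<m. openin X (U i) \<and> P (U i)) \<and> (\<Union>i<m. U i) = topspace X)})"

text \<open>
  Compressibility is meant for closed invariant \<open>A\<close>.  This is deliberately not part
  of the condition, so that no separation axiom is needed in order to take \<open>A\<close> to be a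
  fixed point.
\<close>

definition G_compressible ::
    "('g, 'm) monoid_scheme \<Rightarrow> 'a topology \<Rightarrow> ('g \<Rightarrow> 'a \<Rightarrow> 'a) \<Rightarrow> 'a set \<Rightarrow> 'a set \<Rightarrow> bool" where
  "G_compressible G X \<phi> A U \<longleftrightarrow>
     openin X U \<and> G_invariant G \<phi> U \<and>
     (\<exists>c. inclusion_G_homotopic G X \<phi> U c \<and> c ` U \<subseteq> A)"

definition relative_G_category ::
    "('g, 'm) monoid_scheme \<Rightarrow> 'a topology \<Rightarrow> ('g \<Rightarrow> 'a \<Rightarrow> 'a) \<Rightarrow> 'a set \<Rightarrow> enat" where
  "relative_G_category G X \<phi> A = open_cover_number X (G_compressible G X \<phi> A)"

definition G_categorical ::
    "('g, 'm) monoid_scheme \<Rightarrow> 'a topology \<Rightarrow> ('g \<Rightarrow> 'a \<Rightarrow> 'a) \<Rightarrow> 'a set \<Rightarrow> bool" where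
  "G_categorical G X \<phi> U \<longleftrightarrow>
     U \<subseteq> topspace X \<and> G_invariant G \<phi> U \<and>
     (\<exists>c. inclusion_G_homotopic G X \<phi> U c \<and> (\<exists>x\<in>topspace X. c ` U \<subseteq> orbit G \<phi> x))"

definition G_category ::
    "('g, 'm) monoid_scheme \<Rightarrow> 'a topology \<Rightarrow> ('g \<Rightarrow> 'a \<Rightarrow> 'a) \<Rightarrow> enat" where
  "G_category G X \<phi> = open_cover_number X (G_categorical G X \<phi>)"

section \<open>Invariant topological complexity\<close>

text \<open>
  Continuous maps are represented by their extensional representatives.  The choice
  \<open>K = {}\<close> in the subbasis shows that the underlying set is the set of all of them.
\<close>

definition compact_open_topology :: "'a topology \<Rightarrow> 'b topology \<Rightarrow> ('a \<Rightarrow> 'b) topology" where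
  "compact_open_topology X Y =
     topology_generated_by
       {{f \<in> extensional (topspace X). continuous_map X Y f \<and> f ` K \<subseteq> V} | K V.
          compactin X K \<and> openin Y V}"

lemma topspace_compact_open_topology:
  "topspace (compact_open_topology X Y) = {f \<in> extensional (topspace X). continuous_map X Y f}"
proof -
  have "{f \<in> extensional (topspace X). continuous_map X Y f \<and> f ` {} \<subseteq> {}} \<in>
      {{f \<in> extensional (topspace X). continuous_map X Y f \<and> f ` K \<subseteq> V} | K V.
          compactin X K \<and> openin Y V}"
    by blast
  then show ?thesis
    unfolding compact_open_topology_def topology_generated_by_topspace by auto
qed

definition path_space :: "'a topology \<Rightarrow> (real \<Rightarrow> 'a) topology" where
  "path_space X = compact_open_topology (top_of_set {0..1}) X"

definition path_action :: "('g \<Rightarrow> 'a \<Rightarrow> 'a) \<Rightarrow> 'g \<Rightarrow> (real \<Rightarrow> 'a) \<Rightarrow> real \<Rightarrow> 'a" where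
  "path_action \<phi> g \<gamma> = (\<lambda>t\<in>{0..1}. \<phi> g (\<gamma> t))"

definition broken_path_space ::
    "('g, 'm) monoid_scheme \<Rightarrow> 'a topology \<Rightarrow> ('g \<Rightarrow> 'a \<Rightarrow> 'a) \<Rightarrow>
      ((real \<Rightarrow> 'a) \<times> (real \<Rightarrow> 'a)) topology" where
  "broken_path_space G X \<phi> =
     subtopology (prod_topology (path_space X) (path_space X))
       {(\<gamma>, \<delta>). orbit G \<phi> (\<gamma> 1) = orbit G \<phi> (\<delta> 0)}"

definition broken_path_ends :: "(real \<Rightarrow> 'a) \<times> (real \<Rightarrow> 'a) \<Rightarrow> 'a \<times> 'a" where
  "broken_path_ends = (\<lambda>(\<gamma>, \<delta>). (\<gamma> 0, \<delta> 1))"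

definition has_invariant_section ::
    "('g, 'm) monoid_scheme \<Rightarrow> 'a topology \<Rightarrow> ('g \<Rightarrow> 'a \<Rightarrow> 'a) \<Rightarrow> ('a \<times> 'a) set \<Rightarrow> bool" where
  "has_invariant_section G X \<phi> U \<longleftrightarrow>
     (\<exists>s. continuous_map (subtopology (prod_topology X X) U) (broken_path_space G X \<phi>) s \<and>
          G_equivariant (G \<times>\<times> G) (product_action \<phi> \<phi>)
            (product_action (path_action \<phi>) (path_action \<phi>)) U s \<and>
          (\<forall>z\<in>U. broken_path_ends (s z) = z))"

definition invariant_TC ::
    "('g, 'm) monoid_scheme \<Rightarrow> 'a topology \<Rightarrow> ('g \<Rightarrow> 'a \<Rightarrow> 'a) \<Rightarrow> enat" where
  "invariant_TC G X \<phi> =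
     open_cover_number (prod_topology X X)
       (\<lambda>U. G_invariant (G \<times>\<times> G) (product_action \<phi> \<phi>) U \<and> has_invariant_section G X \<phi> U)"

end

theory Submission
  imports Defs
begin

text \<open>
  Restrict a section over an invariant open \<open>U\<close> to the slice of the points \<open>x\<close> with
  \<open>(x, p) \<in> U\<close>, and let \<open>(\<gamma>, \<delta>)\<close> be its value at \<open>(x, p)\<close>.  Since \<open>p\<close> is fixed,
  equivariance in the second factor forces every point of \<open>\<delta>\<close> to be fixed.  Hence the orbit
  of \<open>\<delta> 0\<close> is a single point, the brokenness disappears, \<open>\<gamma> 1 = \<delta> 0\<close>, and running along
  \<open>\<gamma>\<close> and then \<open>\<delta>\<close> compresses the slice equivariantly into \<open>{p}\<close>.
\<close>

text \<open>If \<open>f x\<close> lies in the open set \<open>V\<close>, the hypothesis gives a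
  compact neighbourhood \<open>K\<close> of \<open>x\<close> that \<open>f\<close> maps into
  \<open>V\<close>. An open \<open>W\<close> with \<open>x\<close> in \<open>W\<close> and
  \<open>W\<close> inside \<open>K\<close>, times the subbasic set of maps sending \<open>K\<close>
  into \<open>V\<close>, is then an open box around \<open>(x, f)\<close> on which evaluation stays
  in \<open>V\<close>.\<close>

lemma continuous_map_compact_open_eval:
  assumes "neighbourhood_base_of (compactin X) X"
  shows "continuous_map (prod_topology X (compact_open_topology X Y)) Y (\<lambda>(x, f). f x)"
  unfolding continuous_map_def
proof (intro conjI allI impI)
  show "(\<lambda>(x, f). f x) \<in>
      topspace (prod_topology X (compact_open_topology X Y)) \<rightarrow> topspace Y"
    by (auto simp: topspace_compact_open_topology continuous_map_def)
next
  fix V assume V: "openin Y V"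
  let ?E = "{z \<in> topspace (prod_topology X (compact_open_topology X Y)).
              (case z of (x, f) \<Rightarrow> f x) \<in> V}"
  have "\<exists>A. openin (prod_topology X (compact_open_topology X Y)) A \<and> z \<in> A \<and> A \<subseteq> ?E"
    if z: "z \<in> ?E" for z
  proof -
    obtain x f where xf: "z = (x, f)" "x \<in> topspace X" "f \<in> extensional (topspace X)"
      "continuous_map X Y f" "f x \<in> V"
      using z by (auto simp: topspace_compact_open_topology)
    have "openin X {y \<in> topspace X. f y \<in> V} \<and> x \<in> {y \<in> topspace X. f y \<in> V}"
      using openin_continuous_map_preimage[OF xf(4) V] xf(2,5) by simp
    from assms[unfolded neighbourhood_base_of, rule_format, OF this] obtain W K where WK: "openin X W" "compactin X K" "x \<in> W" "W \<subseteq> K"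
      "K \<subseteq> {y \<in> topspace X. f y \<in> V}"
      by (elim exE conjE)
    let ?B = "{f \<in> extensional (topspace X). continuous_map X Y f \<and> f ` K \<subseteq> V}"
    have "openin (compact_open_topology X Y) ?B"
      unfolding compact_open_topology_def
      using WK(2) V by (intro topology_generated_by_Basis) blast
    then have "openin (prod_topology X (compact_open_topology X Y)) (W \<times> ?B)"
      using WK(1) by (simp add: openin_prod_Times_iff)
    moreover have "z \<in> W \<times> ?B" using xf WK by auto
    moreover have "W \<times> ?B \<subseteq> ?E"
      using WK(4,5) by (auto simp: topspace_compact_open_topology)
    ultimately show ?thesis by blast
  qed
  then show "openin (prod_topology X (compact_open_topology X Y)) ?E"
    by (subst openin_subopen) blast
qed

text \<open>Uncurrying: the unit interval is locally compact Hausdorff, so evaluation on it is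
  continuous, and a continuous family of paths becomes a candidate for a homotopy.\<close>

lemma continuous_map_path_space_eval:
  assumes "continuous_map Z (path_space X) \<sigma>"
  shows "continuous_map (prod_topology (top_of_set {0..1}) Z) X (\<lambda>(t, z). \<sigma> z t)"
proof -
  have "locally_compact_space (top_of_set {0..1::real})"
    by (simp add: compact_imp_locally_compact_space compact_space_subtopology)
  moreover have "Hausdorff_space (top_of_set {0..1::real})"
    by (simp add: Hausdorff_space_subtopology)
  ultimately have "neighbourhood_base_of (compactin (top_of_set {0..1})) (top_of_set {0..1::real})"
    using locally_compact_space_neighbourhood_base by blast
  from continuous_map_compact_open_eval[OF this]
  have ev: "continuous_map (prod_topology (top_of_set {0..1}) (path_space X)) X (\<lambda>(t, f). f t)"
    unfolding path_space_def .
  have "continuous_map (prod_topology (top_of_set {0..1::real}) Z)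
      (prod_topology (top_of_set {0..1}) (path_space X)) (\<lambda>w. (fst w, \<sigma> (snd w)))"
    using assms by (intro continuous_map_paired[THEN iffD2] conjI continuous_map_fst
        continuous_map_compose[OF continuous_map_snd, unfolded o_def])
  from continuous_map_compose[OF this ev] show ?thesis
    by (simp add: o_def case_prod_unfold)
qed

text \<open>Uncurrying \<open>\<sigma>\<close> gives the homotopy; each stage is equivariant because
  \<open>path_action\<close> acts pointwise in time. The ends \<open>a\<close> and \<open>b\<close>
  are arbitrary so that homotopies along successive families of paths can be composed.\<close>

lemma G_homotopic_along_paths:
  assumes "V \<subseteq> topspace X" and "G_invariant G \<phi> V"
    and "continuous_map (subtopology X V) (path_space X) \<sigma>"
    and "\<And>g x. g \<in> carrier G \<Longrightarrow> x \<in> V \<Longrightarrow> \<sigma> (\<phi> g x) = path_action \<phi> g (\<sigma> x)"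
    and "\<And>x. x \<in> V \<Longrightarrow> a x = \<sigma> x 0" and "\<And>x. x \<in> V \<Longrightarrow> b x = \<sigma> x 1"
  shows "homotopic_with (G_equivariant G \<phi> \<phi> V) (subtopology X V) X a b"
proof -
  have V: "topspace (subtopology X V) = V" using assms(1) by auto
  show ?thesis
  proof (subst homotopic_with, unfold V)
    \<comment> \<open>Equivariance on \<open>V\<close> depends only on the values on
      \<open>V\<close>, since invariance keeps \<open>\<phi> g x\<close> in
      \<open>V\<close>.\<close>
    show "G_equivariant G \<phi> \<phi> V h \<longleftrightarrow> G_equivariant G \<phi> \<phi> V k"
      if "\<And>x. x \<in> V \<Longrightarrow> h x = k x" for h k
      using assms(2) that by (simp add: G_equivariant_def G_invariant_def)
  next
    show "\<exists>h. continuous_map (prod_topology (top_of_set {0..1::real}) (subtopology X V)) X h \<and>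
        (\<forall>x\<in>V. h (0, x) = a x) \<and> (\<forall>x\<in>V. h (1, x) = b x) \<and>
        (\<forall>t\<in>{0..1}. G_equivariant G \<phi> \<phi> V (\<lambda>x. h (t, x)))"
    proof (intro exI[of _ "\<lambda>(t, x). \<sigma> x t"] conjI ballI)
      show "continuous_map (prod_topology (top_of_set {0..1}) (subtopology X V)) X
          (\<lambda>(t, x). \<sigma> x t)"
        using assms(3) by (rule continuous_map_path_space_eval)
      show "G_equivariant G \<phi> \<phi> V (\<lambda>x. case (t, x) of (t, x) \<Rightarrow> \<sigma> x t)"
        if "t \<in> {0..1}" for t
        using assms(4) that by (simp add: G_equivariant_def path_action_def)
    qed (simp_all add: assms(5,6))
  qed
qed

lemma G_compressible_slice:
  assumes "group_action G (topspace X) \<phi>" and p: "p \<in> fixed_points G \<phi> X"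
    and U: "openin (prod_topology X X) U"
    and inv: "G_invariant (G \<times>\<times> G) (product_action \<phi> \<phi>) U"
    and sect: "has_invariant_section G X \<phi> U"
  shows "G_compressible G X \<phi> {p} {x \<in> topspace X. (x, p) \<in> U}"
proof -
  interpret group_action G "topspace X" \<phi> by fact
  interpret group G by (rule group_hom.axioms(1)[OF group_hom])
  let ?V = "{x \<in> topspace X. (x, p) \<in> U}"
  have pX: "p \<in> topspace X" and fix_p: "\<And>g. g \<in> carrier G \<Longrightarrow> \<phi> g p = p"
    using p by (auto simp: fixed_points_def)
  have U_sub: "U \<subseteq> topspace X \<times> topspace X" using openin_subset[OF U] by simp
  obtain s where
    cont: "continuous_map (subtopology (prod_topology X X) U) (broken_path_space G X \<phi>) s"
    and equi: "G_equivariant (G \<times>\<times> G) (product_action \<phi> \<phi>)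
      (product_action (path_action \<phi>) (path_action \<phi>)) U s"
    and ends: "\<And>z. z \<in> U \<Longrightarrow> broken_path_ends (s z) = z"
    using sect unfolding has_invariant_section_def by blast
  define \<gamma> where "\<gamma> x = fst (s (x, p))" for x
  define \<delta> where "\<delta> x = snd (s (x, p))" for x
  have slice: "continuous_map X (prod_topology X X) (\<lambda>x. (x, p))"
    using pX by (simp add: continuous_map_paired)
  have openV: "openin X ?V"
    using openin_continuous_map_preimage[OF slice U] .
  have invV: "G_invariant G \<phi> ?V"
    unfolding G_invariant_def
  proof (intro ballI)
    fix g x assume "g \<in> carrier G" "x \<in> ?V"
    \<comment> \<open>As \<open>p\<close> is fixed, the diagonal element moves \<open>(x, p)\<close>
      to \<open>(\<phi> g x, p)\<close>, which is again in the slice.\<close>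
    then have "product_action \<phi> \<phi> (g, g) (x, p) \<in> U"
      using inv unfolding G_invariant_def by (auto simp: DirProd_def)
    with \<open>g \<in> carrier G\<close> U_sub show "\<phi> g x \<in> ?V"
      by (auto simp: product_action_def fix_p)
  qed
  \<comment> \<open>The pair \<open>(g, h)\<close> sends \<open>(x, p)\<close> to
    \<open>(\<phi> g x, p)\<close> whatever \<open>h\<close> is, so in the second equation
    \<open>h\<close> is independent of \<open>g\<close>.\<close>
  have equi': "\<gamma> (\<phi> g x) = path_action \<phi> g (\<gamma> x)" "\<delta> (\<phi> g x) = path_action \<phi> h (\<delta> x)"
    if "g \<in> carrier G" "h \<in> carrier G" "x \<in> ?V" for g h x
  proof -
    have "s (product_action \<phi> \<phi> (g, h) (x, p)) =
        product_action (path_action \<phi>) (path_action \<phi>) (g, h) (s (x, p))"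
      using equi that unfolding G_equivariant_def by (auto simp: DirProd_def)
    then show "\<gamma> (\<phi> g x) = path_action \<phi> g (\<gamma> x)" "\<delta> (\<phi> g x) = path_action \<phi> h (\<delta> x)"
      using that by (simp_all add: product_action_def fix_p \<gamma>_def \<delta>_def case_prod_unfold)
  qed
  have cont_s: "continuous_map (subtopology X ?V) (broken_path_space G X \<phi>) (\<lambda>x. s (x, p))"
  proof -
    have "continuous_map (subtopology X ?V) (subtopology (prod_topology X X) U) (\<lambda>x. (x, p))"
      using continuous_map_from_subtopology[OF slice]
      by (auto simp: continuous_map_in_subtopology)
    from continuous_map_compose[OF this cont] show ?thesis by (simp add: o_def)
  qed
  then have cont_\<gamma>: "continuous_map (subtopology X ?V) (path_space X) \<gamma>"
    and cont_\<delta>: "continuous_map (subtopology X ?V) (path_space X) \<delta>"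
    unfolding broken_path_space_def continuous_map_in_subtopology \<gamma>_def \<delta>_def
    by (auto simp: continuous_map_pairwise o_def)
  have orbits: "orbit G \<phi> (\<gamma> x 1) = orbit G \<phi> (\<delta> x 0)" if "x \<in> ?V" for x
    using continuous_map_image_subset_topspace[OF cont_s] that
    unfolding broken_path_space_def \<gamma>_def \<delta>_def by fastforce
  have ends': "\<gamma> x 0 = x" "\<delta> x 1 = p" if "x \<in> ?V" for x
    using ends[of "(x, p)"] that
    by (simp_all add: broken_path_ends_def \<gamma>_def \<delta>_def case_prod_unfold)
  \<comment> \<open>Put \<open>g\<close> equal to the unit in the second equation and leave
    \<open>h\<close> free.\<close>
  have \<delta>_invariant: "path_action \<phi> h (\<delta> x) = \<delta> x" if "h \<in> carrier G" "x \<in> ?V" for h x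
    using equi'(2)[OF one_closed that] that(2) by (simp flip: id_eq_one)
  have meet: "\<gamma> x 1 = \<delta> x 0" if x: "x \<in> ?V" for x
  proof -
    \<comment> \<open>This places \<open>\<gamma> x 1\<close> in the space, hence in its own orbit,
      which is the orbit of \<open>\<delta> x 0\<close>.\<close>
    have "\<gamma> x \<in> topspace (path_space X)"
      using continuous_map_image_subset_topspace[OF cont_\<gamma>] x by auto
    then have "\<gamma> x 1 \<in> topspace X"
      by (auto simp: path_space_def topspace_compact_open_topology continuous_map_def)
    then have "\<gamma> x 1 \<in> orbit G \<phi> (\<delta> x 0)"
      using orbit_refl orbits[OF x] by blast
    \<comment> \<open>Invariance of the path, read at time 0, shrinks that orbit to one
      point.\<close>
    moreover have "\<phi> h (\<delta> x 0) = \<delta> x 0" if "h \<in> carrier G" for h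
      using fun_cong[OF \<delta>_invariant[OF that x], of 0] by (simp add: path_action_def)
    ultimately show ?thesis by (auto simp: orbit_def)
  qed
  \<comment> \<open>Instead of concatenating \<open>\<gamma>\<close> and \<open>\<delta>\<close>,
    one homotopy is built along each and transitivity joins them; \<open>meet\<close> makes the
    second start where the first ends.\<close>
  have "homotopic_with (G_equivariant G \<phi> \<phi> ?V) (subtopology X ?V) X id (\<lambda>x. \<gamma> x 1)"
    using invV cont_\<gamma> equi'(1) ends'(1) by (intro G_homotopic_along_paths[where \<sigma> = \<gamma>]) auto
  moreover have "homotopic_with (G_equivariant G \<phi> \<phi> ?V) (subtopology X ?V) X
      (\<lambda>x. \<gamma> x 1) (\<lambda>x. p)"
    using invV cont_\<delta> equi'(2) ends'(2) meet
    by (intro G_homotopic_along_paths[where \<sigma> = \<delta>]) auto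
  ultimately have "inclusion_G_homotopic G X \<phi> ?V (\<lambda>x. p)"
    unfolding inclusion_G_homotopic_def by (rule homotopic_with_trans)
  with openV invV show ?thesis
    unfolding G_compressible_def by blast
qed

text \<open>Every \<open>m\<close> admissible for \<open>Y\<close> is admissible for
  \<open>X\<close>, and the infimum of a larger set is smaller; if no \<open>m\<close> is admissible
  for \<open>Y\<close>, the right side is infinite.\<close>

lemma open_cover_number_le:
  assumes "\<And>m U. \<lbrakk>\<forall>i<m. openin Y (U i) \<and> Q (U i); (\<Union>i<m. U i) = topspace Y\<rbrakk> \<Longrightarrow>
      \<exists>V :: nat \<Rightarrow> 'a set. (\<forall>i<m. openin X (V i) \<and> P (V i)) \<and> (\<Union>i<m. V i) = topspace X"
  shows "open_cover_number X P \<le> open_cover_number Y Q"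
  unfolding open_cover_number_def
  by (intro Inf_superset_mono image_mono Collect_mono impI conjI; elim conjE exE)
    (assumption, rule assms)

text \<open>A fixed point is its own orbit, so the compressing map already takes its values in a
  single orbit.\<close>

lemma G_compressible_fixed_point_imp_G_categorical:
  assumes "group G" and p: "p \<in> fixed_points G \<phi> X" and "G_compressible G X \<phi> {p} U"
  shows "G_categorical G X \<phi> U"
proof -
  have "orbit G \<phi> p = {p}"
    using p group.is_monoid[OF assms(1), THEN monoid.one_closed]
    by (force simp: orbit_def fixed_points_def)
  moreover have "p \<in> topspace X" using p by (simp add: fixed_points_def)
  ultimately show ?thesis
    using assms(3) openin_subset unfolding G_compressible_def G_categorical_def by metis
qed

theorem proposition2p7:
  fixes G :: "('g, 'm) monoid_scheme" and T :: "'g topology"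
    and X :: "'a topology" and \<phi> :: "'g \<Rightarrow> 'a \<Rightarrow> 'a" and p :: 'a
  assumes "topological_group G T"
    and "compact_space T"
    and "Hausdorff_space T"
    and "G_space G T X \<phi>"
    and "p \<in> fixed_points G \<phi> X"
  shows "relative_G_category G X \<phi> {p} \<le> invariant_TC G X \<phi> \<and>
         G_category G X \<phi> \<le> invariant_TC G X \<phi>"
proof
  interpret G_space G T X \<phi> by fact
  have pX: "p \<in> topspace X" using assms(5) by (simp add: fixed_points_def)
  show relative: "relative_G_category G X \<phi> {p} \<le> invariant_TC G X \<phi>"
    unfolding relative_G_category_def invariant_TC_def
  proof (rule open_cover_number_le)
    fix m and U :: "nat \<Rightarrow> ('a \<times> 'a) set"
    assume U: "\<forall>i<m. openin (prod_topology X X) (U i) \<and>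
        G_invariant (G \<times>\<times> G) (product_action \<phi> \<phi>) (U i) \<and> has_invariant_section G X \<phi> (U i)"
      and cover: "(\<Union>i<m. U i) = topspace (prod_topology X X)"
    have "G_compressible G X \<phi> {p} {x \<in> topspace X. (x, p) \<in> U i}" if "i < m" for i
      using U that by (intro G_compressible_slice[OF group_action_axioms assms(5)]) auto
    \<comment> \<open>For each \<open>x\<close> the point \<open>(x, p)\<close> of the product lies
      in some \<open>U i\<close>, so the slices at \<open>p\<close> cover with the same
      \<open>m\<close>.\<close>
    moreover have "(\<Union>i<m. {x \<in> topspace X. (x, p) \<in> U i}) = topspace X"
      using cover pX by auto
    ultimately show "\<exists>V. (\<forall>i<m. openin X (V i) \<and> G_compressible G X \<phi> {p} (V i)) \<and>
        (\<Union>i<m. V i) = topspace X"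
      by (intro exI[of _ "\<lambda>i. {x \<in> topspace X. (x, p) \<in> U i}"])
        (simp add: G_compressible_def)
  qed
  \<comment> \<open>Any cover by sets compressible into \<open>{p}\<close> serves unchanged as a
    categorical cover.\<close>
  have "G_category G X \<phi> \<le> relative_G_category G X \<phi> {p}"
    unfolding G_category_def relative_G_category_def
    by (rule open_cover_number_le, intro exI conjI)
      (auto intro: G_compressible_fixed_point_imp_G_categorical[OF is_group assms(5)])
  then show "G_category G X \<phi> \<le> invariant_TC G X \<phi>"
    using relative by (rule order_trans)
qed

end
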